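(* Let $k\ge1$. For all $t\in\mathbb{R}$ and pairs $(a,b)\in\{0,1\}\times\{1,\ldots,k+1\}$, there exists a set $F_{a,b}\subset J^k(\mathbb{R})$ satisfying $$\dim_{\mathrm{Top}}J_{f,t}(F_{a,b})=a\quad\text{and}\quad\dim_{\mathrm{Top}}V_{f,t}(F_{a,b})=b$$ for all $f\in C^\infty(\mathbb{R})$. Moreover, $\dim_{\mathrm{Top}}(F_{a,b})=b$.
   Context: Let $k\ge 1$ be an integer. The jet space Carnot group $J^k(\mathbb{R})$ is the set $\mathbb{R}^{k+2}$ (with its Euclidean topology), with points written $(x,u_k,\ldots,u_0)$, equipped with the group operation $(x,u_k,\ldots,u_0)\odot(y,v_k,\ldots,v_0)=(x+y,w_k,\ldots,w_0)$, where $w_k=u_k+v_k$ and $w_s=u_s+v_s+\sum_{j=s+1}^k u_j\frac{y^{j-s}}{(j-s)!}$ for $s=0,\ldots,k-1$; inverses $p^{-1}$ are with respect to $\odot$. $\dim_{\mathrm{Top}}$ is topological (inductive) dimension. For $f\in C^\infty(\mathbb{R})$ and $x\in\mathbb{R}$, $j^k_x(f):=j^k(f)(x):=(x,f^{(k)}(x),f^{(k-1)}(x),\ldots,f(x))\in J^k(\mathbb{R})$, and $\mathrm{im}(j^k(f)):=\{j^k_x(f):x\in\mathbb{R}\}$. For $t\in\mathbb{R}$, $\{x=t\}:=\{(x,u_k,\ldots,u_0)\in J^k(\mathbb{R}):x=t\}$. For $f\in C^\infty(\mathbb{R})$ and $t\in\mathbb{R}$, the vertical mapping $V_{f,t}:J^k(\mathbb{R})\to\{x=t\}$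 and the horizontal mapping $J_{f,t}:J^k(\mathbb{R})\to\mathrm{im}(j^k(f))$ are $V_{f,t}(x,u_k,\ldots,u_0):=(x,u_k,\ldots,u_0)\odot j^k_{x-t}(f)^{-1}$ and $J_{f,t}(x,u_k,\ldots,u_0):=j^k_{x-t}(f)$. *)

theory Defs
  imports "HOL-Analysis.Analysis" "HOL-Algebra.Group"
begin

(* The predicate "X dim_le n" is the library's small inductive (Urysohn-Menger) dimension;
   the empty space has dimension -1, and the infimum is \<infinity> if there is no finite bound. *)
definition dim_top :: "'a topology \<Rightarrow> ereal"
  where "dim_top X = (INF n\<in>{n::int. X dim_le n}. ereal (real_of_int n))"

lemma dim_top_eq_int_iff:
  "dim_top X = ereal (real_of_int n) \<longleftrightarrow> X dim_le n \<and> \<not> X dim_le (n - 1)"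
proof
  assume L: "X dim_le n \<and> \<not> X dim_le (n - 1)"
  then have "n \<le> m" if "X dim_le m" for m
    using that dimension_le_mono [of X m "n - 1"] by force
  with L show "dim_top X = ereal (real_of_int n)"
    unfolding dim_top_def by (intro antisym INF_lower2 [of n] INF_greatest) auto
next
  assume R: "dim_top X = ereal (real_of_int n)"
  have "dim_top X < ereal (real_of_int n + 1)"
    by (simp add: R)
  then obtain m where m: "X dim_le m" "ereal (real_of_int m) < ereal (real_of_int n + 1)"
    unfolding dim_top_def INF_less_iff by auto
  then have "m \<le> n" by simp
  with m have 1: "X dim_le n"
    using dimension_le_mono by blast
  have "\<not> X dim_le (n - 1)"
  proof
    assume "X dim_le (n - 1)"
    then have "dim_top X \<le> ereal (real_of_int (n - 1))"
      unfolding dim_top_def by (intro INF_lower) auto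
    with R show False by simp
  qed
  with 1 show "X dim_le n \<and> \<not> X dim_le (n - 1)" by simp
qed

(* The point (x, u_k, ..., u_0) is encoded as the pair (x, u) with u s = u_s for s \<le> k, and
   with u s = 0 for s > k, so that the second component ranges over Euclidean_space (k + 1). *)
type_synonym jet_point = "real \<times> (nat \<Rightarrow> real)"

definition jet_topology :: "nat \<Rightarrow> jet_point topology"
  where "jet_topology k = prod_topology euclideanreal (Euclidean_space (k + 1))"

definition jet_space :: "nat \<Rightarrow> jet_point set"
  where "jet_space k = {(x, u). \<forall>s>k. u s = 0}"

lemma topspace_jet_topology: "topspace (jet_topology k) = jet_space k"
  by (auto simp: jet_topology_def jet_space_def topspace_Euclidean_space Suc_le_eq)

(* For s \<ge> k the sum is empty: this gives w_k = u_k + v_k, and w_s = 0 for s > k. *)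
definition jet_mult :: "nat \<Rightarrow> jet_point \<Rightarrow> jet_point \<Rightarrow> jet_point"
  where "jet_mult k = (\<lambda>(x, u) (y, v).
    (x + y, \<lambda>s. u s + v s + (\<Sum>j = s + 1..k. u j * (y ^ (j - s) / fact (j - s)))))"

definition jet_group :: "nat \<Rightarrow> jet_point monoid"
  where "jet_group k = \<lparr>carrier = jet_space k, mult = jet_mult k, one = (0, \<lambda>s. 0)\<rparr>"

definition jet_shift :: "nat \<Rightarrow> real \<Rightarrow> (nat \<Rightarrow> real) \<Rightarrow> nat \<Rightarrow> real"
  where "jet_shift k y u s = (\<Sum>j = s..k. u j * (y ^ (j - s) / fact (j - s)))"

lemma jet_mult_shift:
  assumes "(x, u) \<in> jet_space k"
  shows "jet_mult k (x, u) (y, v) = (x + y, \<lambda>s. jet_shift k y u s + v s)"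
proof -
  have "jet_shift k y u s = u s + (\<Sum>j = s + 1..k. u j * (y ^ (j - s) / fact (j - s)))" for s
  proof (cases "s \<le> k")
    case True
    then show ?thesis by (simp add: jet_shift_def sum.atLeast_Suc_atMost)
  next
    case False
    with assms show ?thesis by (simp add: jet_shift_def jet_space_def)
  qed
  then show ?thesis by (simp add: jet_mult_def fun_eq_iff)
qed

lemma jet_shift_in: "(x, jet_shift k y u) \<in> jet_space k"
  by (simp add: jet_space_def jet_shift_def)

lemma jet_shift_0:
  assumes "(x, u) \<in> jet_space k"
  shows "jet_shift k 0 u = u"
  using jet_mult_shift [OF assms, of 0 "\<lambda>s. 0"] by (simp add: jet_mult_def fun_eq_iff power_0_left)

lemma jet_shift_add: "jet_shift k y (\<lambda>s. u s + v s) s = jet_shift k y u s + jet_shift k y v s"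
  by (simp add: jet_shift_def distrib_right sum.distrib del: times_divide_eq_right)

lemma jet_shift_minus: "jet_shift k y (\<lambda>s. - u s) s = - jet_shift k y u s"
  by (simp add: jet_shift_def sum_negf)

lemma jet_shift_shift: "jet_shift k z (jet_shift k y u) s = jet_shift k (y + z) u s"
proof -
  have binom: "(y + z) ^ n / fact n = (\<Sum>i\<le>n. y ^ (n - i) / fact (n - i) * (z ^ i / fact i))"
    for n
    using exp_series_add_commuting [of z y n]
    by (simp add: add.commute scaleR_conv_of_real divide_inverse mult_ac)
  have inner: "(\<Sum>i = s..j. y ^ (j - i) / fact (j - i) * (z ^ (i - s) / fact (i - s)))
      = (y + z) ^ (j - s) / fact (j - s)" if "s \<le> j" for j
  proof -
    have "(\<Sum>i = s..j. y ^ (j - i) / fact (j - i) * (z ^ (i - s) / fact (i - s)))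
        = (\<Sum>i\<le>j - s. y ^ (j - s - i) / fact (j - s - i) * (z ^ i / fact i))"
      by (rule sum.reindex_bij_witness [of _ "\<lambda>i. i + s" "\<lambda>i. i - s"]) (use that in auto)
    then show ?thesis by (simp add: binom)
  qed
  have "jet_shift k z (jet_shift k y u) s
      = (\<Sum>i = s..k. \<Sum>j = i..k. u j * (y ^ (j - i) / fact (j - i) * (z ^ (i - s) / fact (i - s))))"
    by (simp add: jet_shift_def sum_distrib_right mult.assoc del: times_divide_eq_right times_divide_eq_left)
  also have "\<dots> = (\<Sum>j = s..k. \<Sum>i = s..j. u j * (y ^ (j - i) / fact (j - i) * (z ^ (i - s) / fact (i - s))))"
    by (simp add: sum.Sigma del: times_divide_eq_right times_divide_eq_left)
       (rule sum.reindex_bij_witness [of _ "\<lambda>(j, i). (i, j)" "\<lambda>(i, j). (j, i)"], auto)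
  also have "\<dots> = (\<Sum>j = s..k. u j * ((y + z) ^ (j - s) / fact (j - s)))"
    by (intro sum.cong refl) (simp add: sum_distrib_left [symmetric] inner del: times_divide_eq_right times_divide_eq_left)
  finally show ?thesis by (simp add: jet_shift_def)
qed

lemma group_jet_group: "group (jet_group k)"
proof (rule groupI; clarsimp simp: jet_group_def)
  fix x u y v
  assume *: "(x, u) \<in> jet_space k" "(y, v) \<in> jet_space k"
  then show in_sp: "jet_mult k (x, u) (y, v) \<in> jet_space k"
    by (simp add: jet_mult_def jet_space_def)
  fix z w
  assume "(z, w) \<in> jet_space k"
  moreover have "(x + y, \<lambda>s. jet_shift k y u s + v s) \<in> jet_space k"
    using in_sp * by (simp add: jet_mult_shift)
  ultimately show "jet_mult k (jet_mult k (x, u) (y, v)) (z, w)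
      = jet_mult k (x, u) (jet_mult k (y, v) (z, w))"
    using * by (simp add: jet_mult_shift jet_shift_add jet_shift_shift add.assoc)
next
  show "(0, \<lambda>s. 0) \<in> jet_space k" by (simp add: jet_space_def)
next
  fix x u
  assume *: "(x, u) \<in> jet_space k"
  then show "jet_mult k (0, \<lambda>s. 0) (x, u) = (x, u)" by (simp add: jet_mult_def)
  have in_sp: "(- x, \<lambda>s. - jet_shift k (- x) u s) \<in> jet_space k"
    using jet_shift_in [of "- x" k "- x" u] by (simp add: jet_space_def)
  have "jet_mult k (- x, \<lambda>s. - jet_shift k (- x) u s) (x, u) = (0, \<lambda>s. 0)"
    using * by (simp add: jet_mult_shift [OF in_sp] jet_shift_minus jet_shift_shift jet_shift_0)
  with in_sp show "\<exists>q\<in>jet_space k. jet_mult k q (x, u) = (0, \<lambda>s. 0)" by blast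
qed

definition smooth_real :: "(real \<Rightarrow> real) \<Rightarrow> bool"
  where "smooth_real f \<longleftrightarrow> (\<forall>n. (deriv ^^ n) f differentiable_on UNIV)"

definition jet :: "nat \<Rightarrow> (real \<Rightarrow> real) \<Rightarrow> real \<Rightarrow> jet_point"
  where "jet k f x = (x, \<lambda>s. if s \<le> k then (deriv ^^ s) f x else 0)"

definition vert_map :: "nat \<Rightarrow> (real \<Rightarrow> real) \<Rightarrow> real \<Rightarrow> jet_point \<Rightarrow> jet_point"
  where "vert_map k f t p = p \<otimes>\<^bsub>jet_group k\<^esub> inv\<^bsub>jet_group k\<^esub> (jet k f (fst p - t))"

definition horiz_map :: "nat \<Rightarrow> (real \<Rightarrow> real) \<Rightarrow> real \<Rightarrow> jet_point \<Rightarrow> jet_point"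
  where "horiz_map k f t p = jet k f (fst p - t)"

lemma jet_in: "jet k f x \<in> jet_space k"
  by (simp add: jet_def jet_space_def)

lemma vert_map_horiz_map:
  assumes "p \<in> jet_space k"
  shows "vert_map k f t p \<otimes>\<^bsub>jet_group k\<^esub> horiz_map k f t p = p"
proof -
  interpret group "jet_group k" by (rule group_jet_group)
  have c: "carrier (jet_group k) = jet_space k" by (simp add: jet_group_def)
  then have "p \<in> carrier (jet_group k)" "jet k f (fst p - t) \<in> carrier (jet_group k)"
    using assms jet_in by simp_all
  then show ?thesis
    by (simp add: vert_map_def horiz_map_def m_assoc)
qed

lemma vert_map_in:
  assumes "p \<in> jet_space k"
  shows "vert_map k f t p \<in> {q \<in> jet_space k. fst q = t}"
proof -
  interpret group "jet_group k" by (rule group_jet_group)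
  have c: "carrier (jet_group k) = jet_space k" by (simp add: jet_group_def)
  have "fst (q \<otimes>\<^bsub>jet_group k\<^esub> r) = fst q + fst r" for q r
    by (simp add: jet_group_def jet_mult_def split: prod.splits)
  then have "fst (vert_map k f t p) + (fst p - t) = fst p"
    using vert_map_horiz_map [OF assms, of f t] by (metis fst_conv horiz_map_def jet_def)
  moreover have "vert_map k f t p \<in> carrier (jet_group k)"
    unfolding vert_map_def using assms jet_in by (intro m_closed inv_closed) (simp_all add: c)
  ultimately show ?thesis by (simp add: c)
qed

end

theory Submission
  imports Defs
begin

text \<open>
  Write \<open>E\<close> for the \<open>b\<close>-dimensional flat in \<open>{x = t}\<close> on which only \<open>u\<^sub>0, \<dots>, u\<^sub>b\<^sub>-\<^sub>1\<close> vary,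
  the other coordinates being zero. For \<open>a = 0\<close> take \<open>F = E\<close>. The horizontal map collapses \<open>E\<close> to the
  point \<open>j\<^sup>k\<^sub>0(f)\<close>, and the vertical map is right multiplication by an element with first coordinate
  zero, hence a translation of the fibre \<open>{x = t}\<close>, so that it keeps the dimension \<open>b\<close>. For \<open>a = 1\<close> add
  to \<open>E\<close> the segment \<open>C = {(x, 0, \<dots>, 0) | t \<le> x \<le> t + 1}\<close>. Its horizontal image is an arc of the jet
  of \<open>f\<close>. Its vertical image is a curve with differentiable coordinates, whatever the smooth function
  \<open>f\<close> is; adding such a curve to a flat of dimension \<open>b \<ge> 1\<close> does not raise the dimension.

  What has to be proved is that the small inductive dimension takes the expected values.

  Lower bounds. A space that contains a continuous image of \<open>[0,1]\<^sup>n\<close>, from which the coordinates of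
  the cube can be recovered continuously, does not have dimension \<open>\<le> n - 1\<close>
  (\<open>cube_not_dim_le\<close>). Over a compact space \<open>X\<close> of dimension \<open>\<le> n - 1\<close>, maps from closed subsets
  into \<open>\<real>\<^sup>n - {0}\<close> extend to all of \<open>X\<close> (\<open>dim_le_imp_punct_extends\<close>), whereas extending the
  identity of the boundary of a cube contradicts the Poincare-Miranda theorem.

  Upper bounds. A set is called thin of order \<open>d\<close> if almost all of its sections by coordinate
  hyperplanes are thin of order \<open>d - 1\<close>, the thin sets of order zero being empty. The frontier of a
  coordinate box lies in finitely many coordinate hyperplanes whose positions can be chosen outside a
  null set, so a thin set of order \<open>d\<close> has dimension \<open>\<le> d - 1\<close> (\<open>thin_imp_dim_le\<close>). Unlike the
  dimension itself, thinness is trivially preserved by finite unions, and it is easy to check for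
  flats (\<open>thin_flat\<close>) and for differentiable curves (\<open>thin_curve\<close>).
\<close>

section \<open>Extension of maps into punctured Euclidean space\<close>

text \<open>
  Up to homotopy this is the sphere of dimension \<open>m - 1\<close>. Maps into it are families of real functions
  without common zero, so that \<open>m\<close> can be a term and no normalisation is ever needed.
\<close>

definition punctured :: "nat \<Rightarrow> (nat \<Rightarrow> real) set"
  where "punctured m = {v. \<exists>i<m. v i \<noteq> 0}"

definition punct_extends :: "nat \<Rightarrow> 'a::topological_space set \<Rightarrow> 'a set \<Rightarrow> ('a \<Rightarrow> nat \<Rightarrow> real) \<Rightarrow> bool"
  where "punct_extends m A Z f \<longleftrightarrow>
    (\<exists>g. continuous_on Z g \<and> g ` Z \<subseteq> punctured m \<and> (\<forall>x\<in>A. g x = f x))"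

text \<open>
  Tietze's theorem applied to each coordinate separately, because the product \<open>nat \<Rightarrow> real\<close> is not an
  inner product space.
\<close>

lemma Tietze_sequence_valued:
  fixes f :: "'a::{metric_space,second_countable_topology} \<Rightarrow> nat \<Rightarrow> real"
  assumes "closed A" "continuous_on A f"
  obtains g where "continuous_on UNIV g" "\<And>x. x \<in> A \<Longrightarrow> g x = f x"
proof -
  have "\<exists>h. continuous_on UNIV h \<and> (\<forall>x\<in>A. h x = f x i)" for i
    using Tietze_unbounded [of A "\<lambda>x. f x i" UNIV] assms
    by (metis closed_closedin continuous_on_product_then_coordinatewise subtopology_UNIV)
  then obtain h where "\<And>i. continuous_on UNIV (h i)" "\<And>i x. x \<in> A \<Longrightarrow> h i x = f x i"
    by metis
  then show thesis
    by (intro that [of "\<lambda>x i. h i x"] continuous_on_coordinatewise_then_product) auto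
qed

text \<open>
  The homotopy extension property in the only form needed, for straight-line homotopies. Extend \<open>f\<close>
  by Tietze to a possibly vanishing \<open>F\<close>. The points of \<open>Z\<close> at which the segment from \<open>G\<close> to \<open>F\<close> hits the
  origin form a compact set \<open>C\<close> disjoint from \<open>X\<close>; a Urysohn function that is one on \<open>X\<close> and zero on \<open>C\<close>
  tells how far along the segment one may go.
\<close>

lemma punct_extends_linear_homotopy:
  fixes f G :: "'a::{metric_space,second_countable_topology} \<Rightarrow> nat \<Rightarrow> real"
  assumes X: "compact X" "X \<subseteq> Z" and Z: "compact Z"
    and f: "continuous_on X f"
    and G: "continuous_on Z G" "G ` Z \<subseteq> punctured m"
    and seg: "\<And>x s. \<lbrakk>x \<in> X; 0 \<le> s; s \<le> 1\<rbrakk> \<Longrightarrow> (\<lambda>i. (1 - s) * G x i + s * f x i) \<in> punctured m"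
  shows "punct_extends m X Z f"
proof -
  obtain F where F: "continuous_on UNIV F" "\<And>x. x \<in> X \<Longrightarrow> F x = f x"
    using Tietze_sequence_valued X(1) f compact_imp_closed by metis
  \<comment> \<open>\<open>H i (z, s)\<close> is the \<open>i\<close>-th coordinate of the segment from \<open>G z\<close> to \<open>F z\<close> at time \<open>s\<close>.\<close>
  define H where "H = (\<lambda>i p. (1 - snd p) * G (fst p) i + snd p * F (fst p) i)"
  define C where "C = fst ` {p \<in> Z \<times> {0..1}. \<forall>i<m. H i p = 0}"
  have contG: "continuous_on Z (\<lambda>x. G x i)" and contF: "continuous_on S (\<lambda>x. F x i)" for i S
    by (rule continuous_on_product_then_coordinatewise [OF G(1)])
       (rule continuous_on_product_then_coordinatewise [OF continuous_on_subset [OF F(1)]], simp)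
  have contH: "continuous_on (Z \<times> {0..1}) (H i)" for i
    unfolding H_def
    by (intro continuous_intros continuous_on_compose2 [OF contG] continuous_on_compose2 [OF contF]) auto
  have "{p \<in> Z \<times> {0..1}. \<forall>i<m. H i p = 0} = (Z \<times> {0..1}) \<inter> (\<Inter>i<m. {p \<in> Z \<times> {0..1}. H i p = 0})"
    by auto
  moreover have "closed {p \<in> Z \<times> {0..1::real}. H i p = 0}" for i
    using continuous_closed_preimage_constant [OF contH] Z
    by (simp add: closed_Times compact_imp_closed)
  ultimately have "compact {p \<in> Z \<times> {0..1}. \<forall>i<m. H i p = 0}"
    by (simp only:) (intro compact_Int_closed compact_Times Z closed_INT ballI; simp)
  then have "compact C"
    unfolding C_def by (intro compact_continuous_image continuous_intros)
  have disj: "x \<notin> C" if "x \<in> X" for x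
    using seg [OF that] F(2) [OF that] by (force simp: C_def H_def punctured_def)
  have "continuous_on (X \<union> C) (\<lambda>x. if x \<in> X then 1 else 0 :: real)"
    by (rule continuous_on_cases) (use \<open>compact C\<close> X(1) disj compact_imp_closed in \<open>auto\<close>)
  then obtain \<phi> :: "'a \<Rightarrow> real" where \<phi>: "continuous_on UNIV \<phi>" "\<phi> ` UNIV \<subseteq> {0..1}"
      "\<And>x. x \<in> X \<union> C \<Longrightarrow> \<phi> x = (if x \<in> X then 1 else 0)"
    by (rule Dugundji [of "{0..1}" UNIV "X \<union> C", rotated 3])
       (use \<open>compact C\<close> X(1) in \<open>auto simp: closed_Un compact_imp_closed closed_closedin [symmetric]\<close>)
  have \<phi>01: "0 \<le> \<phi> x" "\<phi> x \<le> 1" for x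
    using \<phi>(2) by (meson atLeastAtMost_iff image_subset_iff UNIV_I)+
  define g where "g = (\<lambda>x i. (1 - \<phi> x) * G x i + \<phi> x * F x i)"
  have "continuous_on Z g"
    unfolding g_def
    by (intro continuous_on_coordinatewise_then_product continuous_intros contG contF
         continuous_on_subset [OF \<phi>(1)]) auto
  moreover have "g x \<in> punctured m" if "x \<in> Z" for x
  proof (cases "x \<in> C")
    case True
    with disj \<phi>(3) have "g x = G x" by (auto simp: g_def)
    with G(2) that show ?thesis by auto
  next
    case False
    with that \<phi>01 [of x] have "\<not> (\<forall>i<m. H i (x, \<phi> x) = 0)"
      unfolding C_def by force
    then show ?thesis by (auto simp: H_def g_def punctured_def)
  qed
  moreover have "g x = f x" if "x \<in> X" for x
    using that F(2) \<phi>(3) by (simp add: g_def)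
  ultimately show ?thesis
    unfolding punct_extends_def by blast
qed

text \<open>
  This raises the number of coordinates by one: it says that a map from \<open>X\<close> to the \<open>m\<close>-sphere is
  inessential as soon as maps from closed subsets of its southern part \<open>L\<close> to the equatorial sphere of
  dimension \<open>m - 1\<close> extend over \<open>L\<close>. Indeed, replace \<open>f\<close> on \<open>L\<close> by an extension over \<open>L\<close> of its restriction to the
  preimage of the equator; this is a homotopy inside the lower half space. The new map \<open>g\<close> has values
  in the upper half space, so it is homotopic to the north pole. Both homotopies are straight.
\<close>

lemma punct_extends_ambient:
  fixes f :: "'a::{metric_space,second_countable_topology} \<Rightarrow> nat \<Rightarrow> real"
  assumes ext: "\<And>A g. \<lbrakk>closed A; A \<subseteq> L; continuous_on A g; g ` A \<subseteq> punctured m\<rbrakk> \<Longrightarrow> punct_extends m A L g"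
    and L: "L = {x \<in> X. f x m \<le> 0}"
    and X: "compact X" "X \<subseteq> Z" and Z: "compact Z"
    and f: "continuous_on X f" "f ` X \<subseteq> punctured (Suc m)"
  shows "punct_extends (Suc m) X Z f"
proof -
  have contf: "continuous_on X (\<lambda>x. f x i)" for i
    by (rule continuous_on_product_then_coordinatewise [OF f(1)])
  have clX: "closed X" using X(1) compact_imp_closed by blast
  have clL: "closed L"
    unfolding L using continuous_on_closed_Collect_le [OF contf continuous_on_const clX] by simp
  define E where "E = {x \<in> X. f x m = 0}"
  have clE: "closed E"
    unfolding E_def by (rule continuous_closed_preimage_constant [OF contf clX])
  have EL: "E \<subseteq> L" "E \<subseteq> X" and LX: "L \<subseteq> X" by (auto simp: E_def L)
  have "f ` E \<subseteq> punctured m"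
    using f(2) by (fastforce simp: E_def punctured_def image_subset_iff less_Suc_eq)
  then obtain h where h: "continuous_on L h" "h ` L \<subseteq> punctured m" "\<And>x. x \<in> E \<Longrightarrow> h x = f x"
    using ext [OF clE EL(1) continuous_on_subset [OF f(1) EL(2)]] unfolding punct_extends_def by blast
  define R where "R = {x \<in> X. 0 \<le> f x m}"
  have XLR: "X = L \<union> R" by (auto simp: L R_def)
  have clR: "closed R"
    unfolding R_def using continuous_on_closed_Collect_le [OF continuous_on_const contf clX] by simp
  define g where "g = (\<lambda>x i. if x \<in> L then (if i < m then h x i else if i = m then 0 else f x i) else f x i)"
  have "continuous_on (L \<union> R) (\<lambda>x. g x i)" for i
  proof -
    have hi: "continuous_on L (\<lambda>x. h x i)"
      by (rule continuous_on_product_then_coordinatewise [OF h(1)])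
    have fi: "continuous_on L (\<lambda>x. f x i)" "continuous_on R (\<lambda>x. f x i)"
      using continuous_on_subset [OF contf] XLR by auto
    have "continuous_on L (\<lambda>x. if i < m then h x i else if i = m then 0 else f x i)"
      by (cases i m rule: linorder_cases) (use hi fi in auto)
    moreover have "(if i < m then h x i else if i = m then 0 else f x i) = f x i" if "x \<in> L" "x \<in> R" for x
      using that h(3) [of x] by (auto simp: L R_def E_def)
    ultimately show ?thesis
      unfolding g_def if_distrib [of "\<lambda>F. F i"]
      by (intro continuous_on_cases clL clR) (use fi in auto)
  qed
  then have contg: "continuous_on X g"
    unfolding XLR by (rule continuous_on_coordinatewise_then_product)
  have gm: "g x m \<ge> 0" if "x \<in> X" for x
    using that by (auto simp: g_def L)
  have g_punct: "g x \<in> punctured (Suc m)" if "x \<in> X" for x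
  proof (cases "x \<in> L")
    case True
    then obtain i where "i < m" "h x i \<noteq> 0" using h(2) by (auto simp: punctured_def)
    with True show ?thesis by (auto simp: g_def punctured_def intro!: exI [of _ i])
  next
    case False
    with f(2) that show ?thesis by (auto simp: g_def punctured_def)
  qed
  \<comment> \<open>The map \<open>g\<close> has values in the closed upper half space and is pushed up to the north pole.\<close>
  have "punct_extends (Suc m) X Z g"
  proof (rule punct_extends_linear_homotopy [where G = "\<lambda>x i. if i = m then 1 else 0"])
    fix x s assume x: "x \<in> X" and s: "0 \<le> (s::real)" "s \<le> 1"
    show "(\<lambda>i. (1 - s) * (if i = m then 1 else 0) + s * g x i) \<in> punctured (Suc m)"
    proof (cases "s = 1")
      case True
      with g_punct [OF x] show ?thesis by simp
    next
      case False
      with s gm [OF x] have "(1 - s) + s * g x m > 0"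
        by (intro add_pos_nonneg) auto
      then show ?thesis by (auto simp: punctured_def intro!: exI [of _ m])
    qed
  qed (use X Z contg in \<open>auto simp: punctured_def intro!: continuous_on_coordinatewise_then_product\<close>)
  then obtain G where G: "continuous_on Z G" "G ` Z \<subseteq> punctured (Suc m)" "\<And>x. x \<in> X \<Longrightarrow> G x = g x"
    unfolding punct_extends_def by blast
  \<comment> \<open>The segment from \<open>g\<close> to \<open>f\<close> is constant outside \<open>L\<close>. Inside, its last coordinate is negative after
    the start unless \<open>f x\<close> lies on the equator, where \<open>g\<close> and \<open>f\<close> agree.\<close>
  show ?thesis
  proof (rule punct_extends_linear_homotopy [OF X Z f(1) G(1,2)])
    fix x s assume x: "x \<in> X" and s: "0 \<le> (s::real)" "s \<le> 1"
    have "(\<lambda>i. (1 - s) * g x i + s * f x i) \<in> punctured (Suc m)"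
    proof (cases "x \<in> L")
      case True
      consider "s = 0" | "s > 0" "f x m < 0" | "f x m = 0"
        using True s by (fastforce simp: L)
      then show ?thesis
      proof cases
        case 1
        with g_punct [OF x] show ?thesis by simp
      next
        case 2
        then have "(1 - s) * g x m + s * f x m \<noteq> 0"
          using True by (simp add: g_def)
        then show ?thesis by (auto simp: punctured_def)
      next
        case 3
        then have "g x = f x" using h(3) [of x] x by (auto simp: g_def E_def fun_eq_iff)
        then have "(\<lambda>i. (1 - s) * g x i + s * f x i) = f x" by (auto simp: algebra_simps)
        with f(2) x show ?thesis by auto
      qed
    next
      case False
      then have "(\<lambda>i. (1 - s) * g x i + s * f x i) = f x" by (auto simp: g_def algebra_simps)
      with f(2) x show ?thesis by auto
    qed
    with G(3) [OF x] show "(\<lambda>i. (1 - s) * G x i + s * f x i) \<in> punctured (Suc m)" by simp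
  qed
qed

text \<open>
  A partial map is extended across the open sets of \<open>\<U>\<close> one at a time. Where the current domain meets
  the closure of such a set \<open>U\<close>, it does so within the frontier of \<open>U\<close>, and the hypothesis on maps from
  subsets of low dimension extends the map from there over the closure.
\<close>

lemma punct_extends_across_frontiers:
  fixes f :: "'a::{metric_space,second_countable_topology} \<Rightarrow> nat \<Rightarrow> real"
  assumes frontier: "\<And>(B :: 'a set) D g. \<lbrakk>compact B; compact D; B \<subseteq> D; top_of_set B dim_le n;
                      continuous_on B g; g ` B \<subseteq> punctured m\<rbrakk> \<Longrightarrow> punct_extends m B D g"
    and "finite \<U>" and "compact X"
    and "\<And>U. U \<in> \<U> \<Longrightarrow> openin (top_of_set X) U \<and> top_of_set (top_of_set X frontier_of U) dim_le n"
    and "A \<inter> \<Union>\<U> = {}" and "A \<subseteq> X"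
    and "punct_extends m A (X - \<Union>\<U>) f"
  shows "punct_extends m A X f"
  using assms(2,4-)
proof (induction \<U> rule: finite_induct)
  case empty
  then show ?case by simp
next
  case (insert U \<U>)
  define Y where "Y = X - \<Union>\<U>"
  have opeU: "openin (top_of_set X) V" if "V \<in> insert U \<U>" for V
    using insert.prems(1) that by blast
  have clX: "closed X" using \<open>compact X\<close> compact_imp_closed by blast
  have closed_diff: "closed (X - \<Union>\<V>)" if "\<V> \<subseteq> insert U \<U>" for \<V>
  proof -
    have "openin (top_of_set X) (\<Union>\<V>)" using opeU that by (intro openin_Union) auto
    then have "closedin (top_of_set X) (X - \<Union>\<V>)"
      by (metis closedin_diff closedin_topspace topspace_euclidean_subtopology)
    then show ?thesis using clX closedin_closed_trans by blast
  qed
  have cY: "closed Y" and cYU: "closed (Y - U)"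
    using closed_diff [of \<U>] closed_diff [of "insert U \<U>"] by (auto simp: Y_def Diff_insert2 Un_commute Diff_eq Int_ac)
  \<comment> \<open>\<open>D\<close> is the part to be filled in, and \<open>B\<close> is where it meets the current domain \<open>Y - U\<close>.\<close>
  define D where "D = Y \<inter> (top_of_set X closure_of U)"
  define B where "B = D - U"
  have cD: "closed D"
  proof -
    have "closed (top_of_set X closure_of U)"
      using closedin_closure_of clX closedin_closed_trans by blast
    then show ?thesis unfolding D_def using cY by blast
  qed
  have UD: "Y \<inter> U \<subseteq> D"
    unfolding D_def using closure_of_subset opeU openin_subset by (metis Int_mono insertI1 order_refl)
  have B: "B = (Y - U) \<inter> D" by (auto simp: B_def D_def)
  have "B \<subseteq> top_of_set X frontier_of U"
    using opeU by (auto simp: B_def D_def frontier_of_def interior_of_openin)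
  then have dimB: "top_of_set B dim_le n"
    using insert.prems(1) dimension_le_subtopologies by blast
  obtain g where g: "continuous_on (Y - U) g" "g ` (Y - U) \<subseteq> punctured m" "\<And>x. x \<in> A \<Longrightarrow> g x = f x"
  proof -
    have "X - \<Union>(insert U \<U>) = Y - U" by (auto simp: Y_def)
    with insert.prems(4) that show thesis by (auto simp: punct_extends_def)
  qed
  have "compact D"
    using compact_Int_closed [OF \<open>compact X\<close> cD] by (simp add: D_def Y_def Int_absorb1 Int_left_absorb Diff_eq Int_ac)
  moreover have "compact B"
    using compact_Int_closed [OF \<open>compact D\<close> cYU] by (simp add: B Int_commute)
  ultimately obtain h where h: "continuous_on D h" "h ` D \<subseteq> punctured m" "\<And>x. x \<in> B \<Longrightarrow> h x = g x"
    using frontier [of B D g] g dimB continuous_on_subset [OF g(1), of B] B unfolding punct_extends_def by blast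
  have Y: "Y = (Y - U) \<union> D" using UD by (auto simp: D_def)
  have "continuous_on ((Y - U) \<union> D) (\<lambda>x. if x \<in> Y - U then g x else h x)"
    using cYU cD g(1) h(1) by (rule continuous_on_cases) (use h(3) B in auto)
  then have "continuous_on Y (\<lambda>x. if x \<in> Y - U then g x else h x)"
    using Y by simp
  moreover have "(\<lambda>x. if x \<in> Y - U then g x else h x) ` Y \<subseteq> punctured m"
    using g(2) h(2) UD by (auto simp: image_subset_iff)
  moreover have "\<forall>x\<in>A. (if x \<in> Y - U then g x else h x) = f x"
    using g(3) insert.prems(2,3) by (auto simp: Y_def)
  ultimately have "punct_extends m A (X - \<Union>\<U>) f"
    unfolding punct_extends_def Y_def by blast
  with insert show ?case by auto
qed

text \<open>
  Induction on \<open>d\<close>. A Tietze extension \<open>F\<close> of \<open>f\<close> vanishes only on a compact set \<open>K\<close> disjoint from \<open>A\<close>.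
  Cover \<open>K\<close> by finitely many open sets that avoid \<open>A\<close> and have frontiers of dimension one less, keep \<open>F\<close>
  outside of them, and fill them in with the preceding lemma. Its hypothesis on the frontiers is
  \<open>punct_extends_ambient\<close>, fed with the induction hypothesis for \<open>m - 1\<close> coordinates.
\<close>

theorem dim_le_imp_punct_extends:
  fixes f :: "'a::{metric_space,second_countable_topology} \<Rightarrow> nat \<Rightarrow> real"
  assumes "top_of_set X dim_le int d - 1" and "compact X" and "closed A" and "A \<subseteq> X"
    and "d \<le> m" and "continuous_on A f" and "f ` A \<subseteq> punctured m"
  shows "punct_extends m A X f"
  using assms
proof (induction d arbitrary: X A m f)
  case 0
  then have "X = {}" by (simp add: null_topspace_iff_trivial [symmetric])
  with 0 show ?case by (simp add: punct_extends_def)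
next
  case (Suc d)
  have ambient: "punct_extends m B D g"
    if B: "compact B" "compact D" "B \<subseteq> D" "top_of_set B dim_le int d - 1"
      and g: "continuous_on B g" "g ` B \<subseteq> punctured m" for B D and g :: "'a \<Rightarrow> nat \<Rightarrow> real"
  proof -
    obtain m' where m: "m = Suc m'" "d \<le> m'" using \<open>Suc d \<le> m\<close> by (cases m) auto
    define L where "L = {x \<in> B. g x m' \<le> 0}"
    have "continuous_on B (\<lambda>x. g x m')" by (rule continuous_on_product_then_coordinatewise [OF g(1)])
    then have "closed L"
      unfolding L_def using continuous_on_closed_Collect_le [OF _ continuous_on_const] B(1) compact_imp_closed by metis
    then have "compact L" using compact_Int_closed [OF B(1)] by (metis (no_types, lifting) Int_absorb1 L_def mem_Collect_eq subsetI)
    have "top_of_set L dim_le int d - 1"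
      using B(4) dimension_le_subtopologies [of euclidean B _ L] by (auto simp: L_def)
    show ?thesis unfolding m
    proof (rule punct_extends_ambient [OF _ L_def B(1,3,2) g(1)])
      show "g ` B \<subseteq> punctured (Suc m')" using g(2) m by simp
      show "punct_extends m' A' L g'" if "closed A'" "A' \<subseteq> L" "continuous_on A' g'" "g' ` A' \<subseteq> punctured m'" for A' g'
        using Suc.IH [OF \<open>top_of_set L dim_le int d - 1\<close> \<open>compact L\<close> that(1,2) m(2) that(3,4)] .
    qed
  qed
  obtain F where F: "continuous_on UNIV F" "\<And>x. x \<in> A \<Longrightarrow> F x = f x"
    using Tietze_sequence_valued Suc.prems by metis
  have contF: "continuous_on S (\<lambda>x. F x i)" for i S
    by (rule continuous_on_product_then_coordinatewise [OF continuous_on_subset [OF F(1)]]) simp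
  define K where "K = {x \<in> X. \<forall>i<m. F x i = 0}"
  have "K = X \<inter> (\<Inter>i<m. {x. F x i = 0})" by (auto simp: K_def)
  moreover have "closed {x. F x i = 0}" for i
    using continuous_closed_preimage_constant [OF contF closed_UNIV] by simp
  ultimately have "compact K"
    using compact_Int_closed [OF \<open>compact X\<close>, of "\<Inter>i<m. {x. F x i = 0}"] by auto
  have disj: "x \<notin> A" if "x \<in> K" for x
    using that F(2) Suc.prems(7) by (force simp: K_def punctured_def)
  have "\<exists>U. x \<in> U \<and> U \<inter> A = {} \<and> openin (top_of_set X) U \<and>
            top_of_set (top_of_set X frontier_of U) dim_le int d - 1" if "x \<in> K" for x
  proof -
    have V: "openin (top_of_set X) (X \<inter> - A)" using Suc.prems(3) by (intro openin_open_Int) auto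
    have x: "x \<in> X \<inter> - A" using that disj by (auto simp: K_def)
    obtain U where U: "x \<in> U" "U \<subseteq> X \<inter> - A" "openin (top_of_set X) U"
        "subtopology (top_of_set X) (top_of_set X frontier_of U) dim_le int (Suc d) - 1 - 1"
      using V x Suc.prems(1) unfolding dimension_le.simps [of "top_of_set X"] by meson
    have "top_of_set X frontier_of U \<subseteq> X" by (metis frontier_of_subset_topspace topspace_euclidean_subtopology)
    with U show ?thesis
      by (intro exI [of _ U]) (auto simp: subtopology_subtopology Int_absorb1)
  qed
  then obtain U where U: "\<And>x. x \<in> K \<Longrightarrow> x \<in> U x \<and> U x \<inter> A = {} \<and> openin (top_of_set X) (U x) \<and>
            top_of_set (top_of_set X frontier_of U x) dim_le int d - 1" by metis
  have "\<exists>W. open W \<and> U x = X \<inter> W" if "x \<in> K" for x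
    using U [OF that] by (simp add: openin_open)
  then obtain W where W: "\<And>x. x \<in> K \<Longrightarrow> open (W x) \<and> U x = X \<inter> W x"
    by metis
  have "K \<subseteq> (\<Union>x\<in>K. W x)" using U W by blast
  then obtain K' where K': "K' \<subseteq> K" "finite K'" "K \<subseteq> (\<Union>x\<in>K'. W x)"
    using W by (rule_tac compactE_image [OF \<open>compact K\<close>, of K W]) auto
  have KU: "K \<subseteq> \<Union>(U ` K')"
  proof
    fix x assume x: "x \<in> K"
    then obtain y where "y \<in> K'" "x \<in> W y" using K'(3) by auto
    moreover from x have "x \<in> X" by (simp add: K_def)
    ultimately show "x \<in> \<Union>(U ` K')" using W K'(1) by blast
  qed
  show ?case
  proof (rule punct_extends_across_frontiers [where \<U> = "U ` K'", OF ambient])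
    show "punct_extends m A (X - \<Union>(U ` K')) f"
      unfolding punct_extends_def
    proof (intro exI [of _ F] conjI)
      show "F ` (X - \<Union>(U ` K')) \<subseteq> punctured m" using KU by (auto simp: K_def punctured_def)
      show "continuous_on (X - \<Union>(U ` K')) F" using F(1) by (rule continuous_on_subset) simp
    qed (use F in auto)
    show "A \<inter> \<Union>(U ` K') = {}" using U K' by blast
  qed (use K' U Suc.prems in auto)
qed

section \<open>Cubes bound the dimension from below\<close>

definition unit_cube :: "nat \<Rightarrow> (nat \<Rightarrow> real) set"
  where "unit_cube n = {x. (\<forall>i<n. 0 \<le> x i \<and> x i \<le> 1) \<and> (\<forall>i\<ge>n. x i = 0)}"

lemma compact_unit_cube: "compact (unit_cube n)"
proof -
  have "unit_cube n = (\<Pi>\<^sub>E i\<in>UNIV. if i < n then {0..1} else {0})"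
    by (auto simp: unit_cube_def PiE_iff extensional_def split: if_splits)
  moreover have "compactin (product_topology (\<lambda>i. euclidean :: real topology) UNIV)
      (\<Pi>\<^sub>E i\<in>UNIV. if i < (n::nat) then {0..1} else {0})"
    unfolding compactin_PiE by auto
  ultimately show ?thesis
    by (simp add: euclidean_product_topology)
qed

lemma tendsto_sequence_coordinates:
  fixes X :: "nat \<Rightarrow> nat \<Rightarrow> real"
  shows "X \<longlonglongrightarrow> l \<longleftrightarrow> (\<forall>i. (\<lambda>p. X p i) \<longlonglongrightarrow> l i)"
  using limitin_componentwise [of "\<lambda>i. euclidean :: real topology" UNIV X l sequentially]
  by (simp add: euclidean_product_topology extensional_def)

text \<open>
  Kuhn's combinatorial lemma, applied to the grid of mesh \<open>1/p\<close> with vertices labelled by the signs of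
  the components of \<open>g\<close>, gives a cell in which every component takes both signs. As \<open>p\<close> grows, a
  subsequence of these cells shrinks to a common zero.
\<close>

theorem Poincare_Miranda:
  assumes g: "continuous_on (unit_cube n) g"
    and neg: "\<And>x i. \<lbrakk>x \<in> unit_cube n; i < n; x i = 0\<rbrakk> \<Longrightarrow> g x i < (0::real)"
    and pos: "\<And>x i. \<lbrakk>x \<in> unit_cube n; i < n; x i = 1\<rbrakk> \<Longrightarrow> 0 < g x i"
  shows "\<exists>x\<in>unit_cube n. \<forall>i<n. g x i = 0"
proof -
  define grid where "grid = (\<lambda>(p::nat) (q::nat \<Rightarrow> nat) i. if i < n then real (q i) / real p else 0)"
  have grid_in: "grid p q \<in> unit_cube n" if "0 < p" "\<And>i. i < n \<Longrightarrow> q i \<le> p" for p q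
    using that by (auto simp: grid_def unit_cube_def field_simps)
  define near where "near = (\<lambda>p (x :: nat \<Rightarrow> real) (y :: nat \<Rightarrow> real). \<forall>i. \<bar>y i - x i\<bar> \<le> 1 / real (Suc p))"
  have "\<exists>x\<in>unit_cube n. \<forall>i<n. (\<exists>y\<in>unit_cube n. near p x y \<and> g y i \<le> 0)
            \<and> (\<exists>y\<in>unit_cube n. near p x y \<and> 0 \<le> g y i)" for p
  proof -
    let ?p = "Suc p"
    \<comment> \<open>The label tells whether the \<open>i\<close>-th component is nonpositive at the grid vertex \<open>q / p\<close>; on the two
      opposite faces it has the values that Kuhn's lemma prescribes.\<close>
    define label where "label = (\<lambda>q i. if g (grid ?p q) i \<le> 0 then 0 else 1 :: nat)"
    obtain q where q: "\<forall>i<n. q i < ?p"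
      "\<forall>i<n. \<exists>r s. (\<forall>j<n. q j \<le> r j \<and> r j \<le> q j + 1) \<and> (\<forall>j<n. q j \<le> s j \<and> s j \<le> q j + 1) \<and> label r i \<noteq> label s i"
    proof (rule kuhn_lemma [of ?p n label])
      show "\<forall>q. (\<forall>i<n. q i \<le> ?p) \<longrightarrow> (\<forall>i<n. q i = 0 \<longrightarrow> label q i = 0)"
      proof (intro allI impI)
        fix q i assume "\<forall>i<n. q i \<le> ?p" "i < n" "q i = 0"
        then have "g (grid ?p q) i < 0" by (intro neg grid_in) (auto simp: grid_def)
        then show "label q i = 0" by (simp add: label_def)
      qed
      show "\<forall>q. (\<forall>i<n. q i \<le> ?p) \<longrightarrow> (\<forall>i<n. q i = ?p \<longrightarrow> label q i = 1)"
      proof (intro allI impI)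
        fix q i assume "\<forall>i<n. q i \<le> ?p" "i < n" "q i = ?p"
        then have "0 < g (grid ?p q) i" by (intro pos grid_in) (auto simp: grid_def)
        then show "label q i = 1" by (simp add: label_def)
      qed
    qed (auto simp: label_def)
    have near_grid: "grid ?p r \<in> unit_cube n \<and> near p (grid ?p q) (grid ?p r)"
      if "\<forall>j<n. q j \<le> r j \<and> r j \<le> q j + 1" for r
    proof
      show "grid ?p r \<in> unit_cube n"
        using that q(1) by (intro grid_in) (fastforce simp: less_Suc_eq_le)+
      show "near p (grid ?p q) (grid ?p r)"
        unfolding near_def
      proof
        fix i
        show "\<bar>grid ?p r i - grid ?p q i\<bar> \<le> 1 / real ?p"
        proof (cases "i < n")
          case True
          then have "real (q i) \<le> real (r i)" "real (r i) \<le> real (q i) + 1"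
            using that by (auto simp flip: of_nat_Suc)
          with True show ?thesis
            by (simp add: grid_def flip: diff_divide_distrib) (simp add: divide_right_mono)
        qed (simp add: grid_def)
      qed
    qed
    show ?thesis
    proof (intro bexI [of _ "grid ?p q"] allI impI)
      show "grid ?p q \<in> unit_cube n" using q(1) by (intro grid_in) (auto simp: less_imp_le)
      fix i assume "i < n"
      then obtain r s where rs: "\<forall>j<n. q j \<le> r j \<and> r j \<le> q j + 1" "\<forall>j<n. q j \<le> s j \<and> s j \<le> q j + 1"
          "label r i \<noteq> label s i" using q(2) by blast
      then have "g (grid ?p r) i \<le> 0 \<and> 0 \<le> g (grid ?p s) i \<or> g (grid ?p s) i \<le> 0 \<and> 0 \<le> g (grid ?p r) i"
        by (auto simp: label_def split: if_splits)
      then show "(\<exists>y\<in>unit_cube n. near p (grid ?p q) y \<and> g y i \<le> 0)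
            \<and> (\<exists>y\<in>unit_cube n. near p (grid ?p q) y \<and> 0 \<le> g y i)"
        using near_grid [OF rs(1)] near_grid [OF rs(2)] by blast
    qed
  qed
  then obtain x where x: "\<And>p. x p \<in> unit_cube n"
     "\<And>p i. i < n \<Longrightarrow> \<exists>y\<in>unit_cube n. near p (x p) y \<and> g y i \<le> 0"
     "\<And>p i. i < n \<Longrightarrow> \<exists>y\<in>unit_cube n. near p (x p) y \<and> 0 \<le> g y i"
    by metis
  obtain l \<sigma> where l: "l \<in> unit_cube n" "strict_mono \<sigma>" "(x \<circ> \<sigma>) \<longlonglongrightarrow> l"
    using compact_unit_cube [of n] x(1) unfolding compact_def by meson
  have limit: "(\<lambda>p. g (y p) i) \<longlonglongrightarrow> g l i"
    if y: "\<And>p. y p \<in> unit_cube n" "\<And>p. near (\<sigma> p) (x (\<sigma> p)) (y p)" for y i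
  proof -
    have "(\<lambda>p. y p j) \<longlonglongrightarrow> l j" for j
    proof -
      have "(\<lambda>p. x (\<sigma> p) j) \<longlonglongrightarrow> l j"
        using l(3) by (simp add: tendsto_sequence_coordinates o_def)
      moreover have "(\<lambda>p. 1 / real (Suc (\<sigma> p))) \<longlonglongrightarrow> 0"
        using LIMSEQ_subseq_LIMSEQ [OF lim_1_over_n [THEN LIMSEQ_Suc] l(2)] by (simp add: o_def)
      then have "(\<lambda>p. y p j - x (\<sigma> p) j) \<longlonglongrightarrow> 0"
        by (rule Lim_null_comparison [rotated]) (use y(2) in \<open>auto simp: near_def\<close>)
      ultimately show ?thesis using tendsto_add by fastforce
    qed
    then have "y \<longlonglongrightarrow> l" by (simp add: tendsto_sequence_coordinates)
    moreover have "continuous_on (unit_cube n) (\<lambda>x. g x i)"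
      by (rule continuous_on_product_then_coordinatewise [OF g])
    ultimately show ?thesis
      using l(1) y(1) continuous_on_sequentially [of "unit_cube n" "\<lambda>x. g x i"] by (simp add: o_def)
  qed
  have "g l i = 0" if i: "i < n" for i
  proof (rule antisym)
    have "\<exists>y. y \<in> unit_cube n \<and> near (\<sigma> p) (x (\<sigma> p)) y \<and> g y i \<le> 0" for p
      using x(2) [OF i] by blast
    then obtain y where "\<And>p. y p \<in> unit_cube n" "\<And>p. near (\<sigma> p) (x (\<sigma> p)) (y p)" and sgn: "\<And>p. g (y p) i \<le> 0"
      by metis
    then have "(\<lambda>p. g (y p) i) \<longlonglongrightarrow> g l i" by (intro limit)
    then show "g l i \<le> 0" by (rule LIMSEQ_le_const2) (simp add: sgn)
    have "\<exists>y. y \<in> unit_cube n \<and> near (\<sigma> p) (x (\<sigma> p)) y \<and> 0 \<le> g y i" for p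
      using x(3) [OF i] by blast
    then obtain y where "\<And>p. y p \<in> unit_cube n" "\<And>p. near (\<sigma> p) (x (\<sigma> p)) (y p)" and sgn: "\<And>p. 0 \<le> g (y p) i"
      by metis
    then have "(\<lambda>p. g (y p) i) \<longlonglongrightarrow> g l i" by (intro limit)
    then show "0 \<le> g l i" by (rule LIMSEQ_le_const) (simp add: sgn)
  qed
  with l(1) show ?thesis by blast
qed

text \<open>
  Otherwise the map \<open>\<pi> - (1/2, \<dots>, 1/2)\<close>, restricted to the part of the image of the cube that lies over
  the faces, would extend without zero. Composed with \<open>\<phi>\<close>, the extension is negative or positive on
  opposite faces of the cube, as the Poincare-Miranda theorem requires, and must vanish somewhere.
\<close>

theorem cube_not_dim_le:
  fixes \<phi> :: "(nat \<Rightarrow> real) \<Rightarrow> 'a::{metric_space,second_countable_topology}" and \<pi> :: "nat \<Rightarrow> 'a \<Rightarrow> real"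
  assumes \<phi>: "continuous_on (unit_cube n) \<phi>" "\<phi> ` unit_cube n \<subseteq> S"
    and \<pi>: "\<And>i. continuous_on S (\<pi> i)" "\<And>x i. \<lbrakk>x \<in> unit_cube n; i < n\<rbrakk> \<Longrightarrow> \<pi> i (\<phi> x) = x i"
  shows "\<not> top_of_set S dim_le int n - 1"
proof
  assume dim: "top_of_set S dim_le int n - 1"
  define K where "K = \<phi> ` unit_cube n"
  have "compact K" unfolding K_def using compact_continuous_image \<phi>(1) compact_unit_cube by blast
  have KS: "K \<subseteq> S" using \<phi>(2) by (simp add: K_def)
  have dimK: "top_of_set K dim_le int n - 1" using dimension_le_subtopologies [OF dim KS] .
  have cont\<pi>: "continuous_on K (\<pi> i)" for i using \<pi>(1) KS continuous_on_subset by blast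
  define A where "A = (\<Union>i<n. {p \<in> K. \<pi> i p = 0} \<union> {p \<in> K. \<pi> i p = 1})"
  have "closed A" unfolding A_def
    using continuous_closed_preimage_constant [OF cont\<pi>] \<open>compact K\<close> compact_imp_closed by blast
  have "A \<subseteq> K" by (auto simp: A_def)
  define f where "f = (\<lambda>p i. \<pi> i p - 1/2)"
  have contf: "continuous_on A f" unfolding f_def
    using cont\<pi> \<open>A \<subseteq> K\<close> by (intro continuous_on_coordinatewise_then_product continuous_intros) (rule continuous_on_subset)
  have "f ` A \<subseteq> punctured n"
    by (auto simp: A_def f_def punctured_def)
  then obtain g where g: "continuous_on K g" "g ` K \<subseteq> punctured n" "\<And>p. p \<in> A \<Longrightarrow> g p = f p"
    using dim_le_imp_punct_extends [OF dimK \<open>compact K\<close> \<open>closed A\<close> \<open>A \<subseteq> K\<close> order_refl contf]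
    unfolding punct_extends_def by blast
  have inA: "\<phi> x \<in> A" if "x \<in> unit_cube n" "i < n" "x i = 0 \<or> x i = 1" for x i
    using that \<pi>(2) [of x i] by (auto simp: A_def K_def)
  obtain x where x: "x \<in> unit_cube n" "\<forall>i<n. (g \<circ> \<phi>) x i = 0"
  proof -
    have "continuous_on (unit_cube n) (g \<circ> \<phi>)"
      using continuous_on_compose \<phi>(1) g(1) unfolding K_def .
    then have "\<exists>x\<in>unit_cube n. \<forall>i<n. (g \<circ> \<phi>) x i = 0"
      by (rule Poincare_Miranda) (use inA g(3) \<pi>(2) in \<open>auto simp: f_def\<close>)
    with that show thesis by blast
  qed
  have "g (\<phi> x) \<in> punctured n"
    using g(2) x(1) by (auto simp: K_def)
  with x(2) show False by (auto simp: punctured_def)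
qed

section \<open>Thin sets bound the dimension from above\<close>

text \<open>
  Almost every section counts, not every one: a set may contain whole pieces of exceptional
  hyperplanes, as a flat \<open>{c\<^sub>i = const}\<close> does. Null sets of exceptions are the right choice because
  finite unions of sets then cause no difficulty.
\<close>

primrec thin :: "(nat \<Rightarrow> 'a \<Rightarrow> real) \<Rightarrow> nat \<Rightarrow> 'a set \<Rightarrow> bool"
  where
    "thin c 0 S \<longleftrightarrow> S = {}"
  | "thin c (Suc d) S \<longleftrightarrow> (\<forall>i. negligible {r. \<not> thin c d (S \<inter> {p. c i p = r})})"

lemma thin_empty: "thin c d {}"
  by (induction d) auto

lemma thin_subset: "\<lbrakk>thin c d S; T \<subseteq> S\<rbrakk> \<Longrightarrow> thin c d T"
proof (induction d arbitrary: S T)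
  case (Suc d)
  have "negligible {r. \<not> thin c d (T \<inter> {p. c i p = r})}" for i
  proof (rule negligible_subset)
    show "negligible {r. \<not> thin c d (S \<inter> {p. c i p = r})}"
      using Suc.prems(1) by simp
    have "T \<inter> {p. c i p = r} \<subseteq> S \<inter> {p. c i p = r}" for r
      using Suc.prems(2) by blast
    from Suc.IH [OF _ this]
    show "{r. \<not> thin c d (T \<inter> {p. c i p = r})} \<subseteq> {r. \<not> thin c d (S \<inter> {p. c i p = r})}"
      by blast
  qed
  then show ?case by simp
qed auto

lemma thin_Un: "\<lbrakk>thin c d S; thin c d T\<rbrakk> \<Longrightarrow> thin c d (S \<union> T)"
proof (induction d arbitrary: S T)
  case (Suc d)
  have "negligible {r. \<not> thin c d ((S \<union> T) \<inter> {p. c i p = r})}" for i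
  proof (rule negligible_subset)
    show "negligible ({r. \<not> thin c d (S \<inter> {p. c i p = r})} \<union> {r. \<not> thin c d (T \<inter> {p. c i p = r})})"
      using Suc.prems by (intro negligible_Un) simp_all
    show "{r. \<not> thin c d ((S \<union> T) \<inter> {p. c i p = r})}
        \<subseteq> {r. \<not> thin c d (S \<inter> {p. c i p = r})} \<union> {r. \<not> thin c d (T \<inter> {p. c i p = r})}"
      using Suc.IH unfolding Int_Un_distrib2 by blast
  qed
  then show ?case by simp
qed auto

lemma thin_UN: "\<lbrakk>finite I; \<And>i. i \<in> I \<Longrightarrow> thin c d (S i)\<rbrakk> \<Longrightarrow> thin c d (\<Union>i\<in>I. S i)"
  by (induction I rule: finite_induct) (auto simp: thin_empty thin_Un)

lemma thin_Suc: "thin c d S \<Longrightarrow> thin c (Suc d) S"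
  using thin_subset [of c d S] by simp

lemma thin_mono:
  assumes "thin c d S" "d \<le> d'"
  shows "thin c d' S"
  using assms(2,1)
  by (induction d' rule: dec_induct) (auto intro: thin_Suc simp del: thin.simps)

text \<open>
  This says that the topology is the coarsest one for which all \<open>c i\<close> are continuous.
\<close>

definition coordinates :: "(nat \<Rightarrow> 'a::topological_space \<Rightarrow> real) \<Rightarrow> bool"
  where "coordinates c \<longleftrightarrow> (\<forall>i. continuous_on UNIV (c i)) \<and>
    (\<forall>V p. open V \<longrightarrow> p \<in> V \<longrightarrow>
      (\<exists>I e. finite I \<and> 0 < e \<and> (\<forall>q. (\<forall>i\<in>I. \<bar>c i q - c i p\<bar> < e) \<longrightarrow> q \<in> V)))"

lemma conegligible_meets_interval:
  assumes "negligible {r. \<not> P r}" "a < (b::real)"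
  obtains r where "a < r" "r < b" "P r"
  using assms open_not_negligible [of "{a<..<b}"] negligible_subset [of "{r. \<not> P r}" "{a<..<b}"]
  by fastforce

text \<open>
  Around a given point choose a coordinate box whose finitely many faces lie in hyperplanes with thin
  sections. The part of the frontier in \<open>S\<close> is contained in the union of these sections, which is thin
  of the preceding order.
\<close>

theorem thin_imp_dim_le:
  fixes c :: "nat \<Rightarrow> 'a::topological_space \<Rightarrow> real"
  assumes c: "coordinates c"
  shows "thin c d S \<Longrightarrow> top_of_set S dim_le int d - 1"
proof (induction d arbitrary: S)
  case 0
  then show ?case by simp
next
  case (Suc d)
  have cont: "continuous_on UNIV (c i)" for i
    using c by (simp add: coordinates_def)
  have "\<exists>U. p \<in> U \<and> U \<subseteq> V \<and> openin (top_of_set S) U \<and>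
          subtopology (top_of_set S) (top_of_set S frontier_of U) dim_le int (Suc d) - 1 - 1"
    if "openin (top_of_set S) V" "p \<in> V" for V p
  proof -
    from that obtain W where W: "open W" "V = S \<inter> W"
      by (auto simp: openin_open)
    with \<open>p \<in> V\<close> c obtain I e where I: "finite I" "0 < e" "\<And>q. (\<forall>i\<in>I. \<bar>c i q - c i p\<bar> < e) \<Longrightarrow> q \<in> W"
      unfolding coordinates_def by (metis IntE)
    have neg: "negligible {r. \<not> thin c d (S \<inter> {q. c i q = r})}" for i
      using Suc.prems by simp
    have "\<exists>l. c i p - e < l \<and> l < c i p \<and> thin c d (S \<inter> {q. c i q = l})"
      and "\<exists>r. c i p < r \<and> r < c i p + e \<and> thin c d (S \<inter> {q. c i q = r})" for i
      using conegligible_meets_interval [OF neg [of i]] I(2)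
      by (metis diff_strict_left_mono diff_zero, metis less_add_same_cancel1)
    then obtain l r
      where l: "\<And>i. c i p - e < l i" "\<And>i. l i < c i p" "\<And>i. thin c d (S \<inter> {q. c i q = l i})"
        and r: "\<And>i. c i p < r i" "\<And>i. r i < c i p + e" "\<And>i. thin c d (S \<inter> {q. c i q = r i})"
      by metis
    \<comment> \<open>the open and the closed box with faces at \<open>l\<close> and \<open>r\<close>\<close>
    define B where "B = (\<Inter>i\<in>I. {q. l i < c i q} \<inter> {q. c i q < r i})"
    define C where "C = (\<Inter>i\<in>I. {q. l i \<le> c i q} \<inter> {q. c i q \<le> r i})"
    have "open B"
      unfolding B_def using I(1) cont
      by (intro open_INT ballI open_Int open_Collect_less continuous_on_const) auto
    have "closed C"
      unfolding C_def using cont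
      by (intro closed_INT ballI closed_Int closed_Collect_le continuous_on_const) auto
    have "B \<subseteq> C" by (auto simp: B_def C_def less_imp_le)
    have ope: "openin (top_of_set S) (S \<inter> B)"
      using \<open>open B\<close> by (rule openin_open_Int)
    have "top_of_set S closure_of (S \<inter> B) \<subseteq> S \<inter> C"
      using \<open>closed C\<close> \<open>B \<subseteq> C\<close> by (intro closure_of_minimal closedin_closed_Int) auto
    moreover have "C - B \<subseteq> (\<Union>i\<in>I. {q. c i q = l i} \<union> {q. c i q = r i})"
      by (force simp: B_def C_def not_less)
    ultimately have "top_of_set S frontier_of (S \<inter> B)
        \<subseteq> (\<Union>i\<in>I. (S \<inter> {q. c i q = l i}) \<union> (S \<inter> {q. c i q = r i}))"
      unfolding frontier_of_def interior_of_openin [OF ope] by blast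
    moreover have "thin c d (\<Union>i\<in>I. (S \<inter> {q. c i q = l i}) \<union> (S \<inter> {q. c i q = r i}))"
      using I(1) l(3) r(3) by (intro thin_UN thin_Un)
    ultimately have "thin c d (top_of_set S frontier_of (S \<inter> B))"
      by (rule thin_subset [rotated])
    moreover have "top_of_set S frontier_of (S \<inter> B) \<subseteq> S"
      by (metis frontier_of_subset_topspace topspace_euclidean_subtopology)
    ultimately have "subtopology (top_of_set S) (top_of_set S frontier_of (S \<inter> B)) dim_le int d - 1"
      using Suc.IH by (simp add: subtopology_subtopology Int_absorb1)
    moreover have "p \<in> S \<inter> B"
      using l(2) r(1) \<open>p \<in> V\<close> W by (auto simp: B_def)
    moreover have "S \<inter> B \<subseteq> V"
    proof
      fix q assume "q \<in> S \<inter> B"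
      moreover have "\<bar>c i q - c i p\<bar> < e" if "l i < c i q" "c i q < r i" for i
        using that l(1) [of i] r(2) [of i] by linarith
      ultimately show "q \<in> V" using I(3) W by (auto simp: B_def)
    qed
    ultimately show ?thesis
      using ope by auto
  qed
  then show ?case
    unfolding dimension_le.simps [of "top_of_set S"] by auto
qed

text \<open>
  A coordinate outside \<open>J\<close> is constant, so all but one of its sections are empty; fixing a coordinate
  in \<open>J\<close> leaves a flat with one free coordinate less.
\<close>

lemma thin_flat:
  assumes "finite J" "card J = d" "\<And>p i. \<lbrakk>p \<in> S; i \<notin> J\<rbrakk> \<Longrightarrow> c i p = w i"
  shows "thin c (Suc d) S"
  using assms
proof (induction d arbitrary: J S w)
  case 0
  then have "c i p = w i" if "p \<in> S" for p i
    using that by (metis card_0_eq empty_iff)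
  then have "{r. \<not> thin c 0 (S \<inter> {p. c i p = r})} \<subseteq> {w i}" for i
    by force
  then have "negligible {r. \<not> thin c 0 (S \<inter> {p. c i p = r})}" for i
    by (rule negligible_subset [OF negligible_sing])
  then show ?case by simp
next
  case (Suc d)
  have "negligible {r. \<not> thin c (Suc d) (S \<inter> {p. c i p = r})}" for i
  proof (cases "i \<in> J")
    case True
    have "thin c (Suc d) (S \<inter> {p. c i p = r})" for r
    proof (rule Suc.IH)
      show "finite (J - {i})" "card (J - {i}) = d"
        using Suc.prems(1,2) True by simp_all
      show "c j p = (w(i := r)) j" if "p \<in> S \<inter> {p. c i p = r}" "j \<notin> J - {i}" for p j
        using that Suc.prems(3) [of p j] by (cases "j = i") auto
    qed
    then show ?thesis by (simp del: thin.simps)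
  next
    case False
    then have "thin c (Suc d) (S \<inter> {p. c i p = r})" if "r \<noteq> w i" for r
      by (rule_tac thin_subset [OF thin_empty]) (use Suc.prems(3) that in auto)
    then have "{r. \<not> thin c (Suc d) (S \<inter> {p. c i p = r})} \<subseteq> {w i}"
      by blast
    then show ?thesis by (rule negligible_subset [OF negligible_sing])
  qed
  then show ?case by (simp only: thin.simps(2) [of c "Suc d"] simp_thms)
qed

text \<open>
  The image under \<open>h\<close> of Lebesgue measure on the interval is a finite measure, so it has only countably
  many atoms.
\<close>

lemma countable_non_negligible_level_sets:
  fixes h :: "real \<Rightarrow> real"
  assumes h: "continuous_on {a..b} h"
  shows "countable {r. \<not> negligible {x \<in> {a..b}. h x = r}}"
proof -
  let ?L = "lebesgue_on {a..b}"
  have meas: "h \<in> borel_measurable ?L"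
    using h by (intro continuous_imp_measurable_on_sets_lebesgue) auto
  have "emeasure lebesgue {a..b} \<noteq> \<infinity>"
    by (simp add: emeasure_lborel_Icc_eq)
  then interpret L: finite_measure ?L
    by (intro finite_measureI) (simp add: emeasure_restrict_space)
  interpret finite_measure "distr ?L borel h"
    using meas by (rule L.finite_measure_distr)
  have "h -` {r} \<inter> {a..b} = {x \<in> {a..b}. h x = r}" for r
    by auto
  then have "measure (distr ?L borel h) {r} = measure lebesgue {x \<in> {a..b}. h x = r}" for r
    using meas by (simp add: measure_distr) (subst measure_restrict_space, auto)
  moreover have "{x \<in> {a..b}. h x = r} \<in> lmeasurable" for r
  proof (rule lmeasurable_compact)
    have "closed {x \<in> {a..b}. h x = r}"
      using h by (rule continuous_closed_preimage_constant) simp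
    then have "compact ({a..b} \<inter> {x \<in> {a..b}. h x = r})"
      by (intro compact_Int_closed compact_Icc)
    moreover have "{a..b} \<inter> {x \<in> {a..b}. h x = r} = {x \<in> {a..b}. h x = r}"
      by blast
    ultimately show "compact {x \<in> {a..b}. h x = r}"
      by (simp only:)
  qed
  ultimately have "{r. \<not> negligible {x \<in> {a..b}. h x = r}} = {r. measure (distr ?L borel h) {r} \<noteq> 0}"
    by (simp add: negligible_iff_measure)
  then show ?thesis using countable_support by simp
qed

text \<open>
  Almost all level sets of a coordinate along the curve are null sets, so almost every section is the
  image of a null set \<open>Z\<close>. Such an image is thin of order one: differentiable functions map null sets
  to null sets, so almost every hyperplane misses it.
\<close>

lemma thin_curve:
  assumes diff: "\<And>i. (\<lambda>x. c i (\<gamma> x)) differentiable_on {a..b::real}"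
  shows "thin c 2 (\<gamma> ` {a..b})"
proof -
  have null: "thin c (Suc 0) (\<gamma> ` Z)" if "negligible Z" "Z \<subseteq> {a..b}" for Z
  proof -
    have "negligible {r. \<not> thin c 0 (\<gamma> ` Z \<inter> {p. c i p = r})}" for i
    proof (rule negligible_subset)
      show "negligible ((\<lambda>x. c i (\<gamma> x)) ` Z)"
        using that(1) differentiable_on_subset [OF diff that(2)]
        by (rule negligible_differentiable_image_negligible [OF order_refl])
      show "{r. \<not> thin c 0 (\<gamma> ` Z \<inter> {p. c i p = r})} \<subseteq> (\<lambda>x. c i (\<gamma> x)) ` Z"
        by (simp only: thin.simps(1)) blast
    qed
    then show ?thesis by (simp only: thin.simps(2) simp_thms)
  qed
  have "negligible {r. \<not> thin c (Suc 0) (\<gamma> ` {a..b} \<inter> {p. c i p = r})}" for i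
  proof (rule negligible_subset)
    have "countable {r. \<not> negligible {x \<in> {a..b}. c i (\<gamma> x) = r}}"
      by (rule countable_non_negligible_level_sets [OF differentiable_imp_continuous_on [OF diff]])
    then show "negligible {r. \<not> negligible {x \<in> {a..b}. c i (\<gamma> x) = r}}"
      by (simp only: negligible_iff_null_sets countable_imp_null_set_lborel null_sets_completionI)
    have "thin c (Suc 0) (\<gamma> ` {a..b} \<inter> {p. c i p = r})"
      if "negligible {x \<in> {a..b}. c i (\<gamma> x) = r}" for r
    proof (rule thin_subset)
      show "thin c (Suc 0) (\<gamma> ` {x \<in> {a..b}. c i (\<gamma> x) = r})"
        using that by (rule null) blast
    qed blast
    then show "{r. \<not> thin c (Suc 0) (\<gamma> ` {a..b} \<inter> {p. c i p = r})}
        \<subseteq> {r. \<not> negligible {x \<in> {a..b}. c i (\<gamma> x) = r}}"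
      by (intro Collect_mono impI) (erule contrapos_nn)
  qed
  then show ?thesis
    by (simp only: thin.simps(2) numeral_2_eq_2 simp_thms)
qed

section \<open>Dimensions of subsets of the jet space\<close>

definition jet_coord :: "nat \<Rightarrow> jet_point \<Rightarrow> real"
  where "jet_coord i p = (case i of 0 \<Rightarrow> fst p | Suc s \<Rightarrow> snd p s)"

lemma jet_coord_simps [simp]: "jet_coord 0 p = fst p" "jet_coord (Suc s) p = snd p s"
  by (simp_all add: jet_coord_def)

lemma coordinates_jet_coord: "coordinates jet_coord"
  unfolding coordinates_def
proof (intro conjI allI impI)
  fix i show "continuous_on UNIV (jet_coord i)"
  proof (cases i)
    case 0
    then show ?thesis by (simp add: jet_coord_def [abs_def] continuous_on_fst)
  next
    case (Suc s)
    have "continuous_on UNIV (\<lambda>p :: jet_point. snd p s)"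
      by (rule continuous_on_product_then_coordinatewise) (intro continuous_intros)
    with Suc show ?thesis by (simp add: jet_coord_def [abs_def])
  qed
next
  fix V and p :: jet_point
  assume "open V" "p \<in> V"
  then obtain A B where AB: "open A" "open B" "p \<in> A \<times> B" "A \<times> B \<subseteq> V"
    by (rule open_prod_elim)
  then obtain X where X: "snd p \<in> Pi\<^sub>E UNIV X" "\<And>s. open (X s)" "finite {s. X s \<noteq> UNIV}" "Pi\<^sub>E UNIV X \<subseteq> B"
    using product_topology_open_contains_basis [of "\<lambda>s. euclidean :: real topology" UNIV B "snd p"]
    by (auto simp: euclidean_product_topology)
  define J where "J = {s. X s \<noteq> UNIV}"
  have "\<exists>e>0. \<forall>y. \<bar>y - snd p s\<bar> < e \<longrightarrow> y \<in> X s" for s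
    using X(1,2) unfolding open_real by (metis PiE_mem UNIV_I)
  then obtain e where e: "\<And>s. 0 < e s" "\<And>s y. \<bar>y - snd p s\<bar> < e s \<Longrightarrow> y \<in> X s"
    by metis
  obtain e0 where e0: "0 < e0" "\<And>y. \<bar>y - fst p\<bar> < e0 \<Longrightarrow> y \<in> A"
    using AB(1,3) unfolding open_real by (metis mem_Sigma_iff prod.collapse)
  define d where "d = Min (insert e0 (e ` J))"
  have fin: "finite (insert e0 (e ` J))" using X(3) by (simp add: J_def)
  show "\<exists>I d. finite I \<and> 0 < d \<and> (\<forall>q. (\<forall>i\<in>I. \<bar>jet_coord i q - jet_coord i p\<bar> < d) \<longrightarrow> q \<in> V)"
  proof (intro exI [of _ "insert 0 (Suc ` J)"] exI [of _ d] conjI allI impI)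
    show "0 < d" unfolding d_def using fin e(1) e0(1) by (subst Min_gr_iff) auto
    fix q assume q: "\<forall>i\<in>insert 0 (Suc ` J). \<bar>jet_coord i q - jet_coord i p\<bar> < d"
    have "d \<le> e0" "\<And>s. s \<in> J \<Longrightarrow> d \<le> e s"
      unfolding d_def using fin by (auto intro: Min_le)
    then have "fst q \<in> A" "\<And>s. s \<in> J \<Longrightarrow> snd q s \<in> X s"
      using q by (force intro: e0(2), force intro: e(2))
    moreover have "snd q s \<in> X s" if "s \<notin> J" for s
      using that by (simp add: J_def)
    ultimately have "fst q \<in> A" "snd q \<in> Pi\<^sub>E UNIV X"
      unfolding PiE_UNIV_domain Pi_iff by blast+
    with X(4) have "q \<in> A \<times> B"
      by (metis SigmaI prod.collapse subsetD)
    with AB(4) show "q \<in> V" by blast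
  qed (use X(3) in \<open>simp add: J_def\<close>)
qed

lemma jet_topology_eq: "jet_topology k = top_of_set (jet_space k)"
proof -
  have "jet_topology k = prod_topology euclidean (top_of_set {u. \<forall>s\<ge>k + 1. u s = 0})"
    by (simp add: jet_topology_def Euclidean_space_def euclidean_product_topology)
  also have "\<dots> = top_of_set (UNIV \<times> {u. \<forall>s\<ge>k + 1. u s = 0})"
    using prod_topology_subtopology_eu [of UNIV] by simp
  also have "UNIV \<times> {u. \<forall>s\<ge>k + 1. u s = 0} = jet_space k"
    by (auto simp: jet_space_def Suc_le_eq)
  finally show ?thesis .
qed

text \<open>
  The common form of all dimension computations below: thinness bounds the dimension from above, and
  the cube \<open>\<phi>\<close> with its coordinates \<open>\<pi>\<close> bounds it from below. The case \<open>n = 0\<close> is included, where the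
  cube is a single point.
\<close>

lemma dim_top_jet_eqI:
  fixes \<pi> :: "nat \<Rightarrow> jet_point \<Rightarrow> real"
  assumes S: "S \<subseteq> jet_space k" and thin: "thin jet_coord (Suc n) S"
    and \<phi>: "continuous_on (unit_cube n) \<phi>" "\<phi> ` unit_cube n \<subseteq> S"
    and \<pi>: "\<And>i. continuous_on UNIV (\<pi> i)" "\<And>x i. \<lbrakk>x \<in> unit_cube n; i < n\<rbrakk> \<Longrightarrow> \<pi> i (\<phi> x) = x i"
  shows "dim_top (subtopology (jet_topology k) S) = ereal (real n)"
proof -
  have "top_of_set S dim_le int n"
    using thin_imp_dim_le [OF coordinates_jet_coord thin] by simp
  moreover have "\<not> top_of_set S dim_le int n - 1"
    by (rule cube_not_dim_le [OF \<phi> continuous_on_subset [OF \<pi>(1)] \<pi>(2)]) auto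
  ultimately have "dim_top (top_of_set S) = ereal (real_of_int (int n))"
    by (simp only: dim_top_eq_int_iff simp_thms)
  with S show ?thesis
    by (simp add: jet_topology_eq subtopology_subtopology Int_absorb1)
qed

definition flat :: "real \<Rightarrow> nat \<Rightarrow> (nat \<Rightarrow> real) \<Rightarrow> jet_point set"
  where "flat t b w = {(x, u). x = t \<and> (\<forall>s\<ge>b. u s = w s)}"

lemma thin_jet_flat: "thin jet_coord (Suc b) (flat t b w)"
proof (rule thin_flat)
  show "finite (Suc ` {..<b})" "card (Suc ` {..<b}) = b"
    by (simp_all add: card_image)
  show "jet_coord i p = (case i of 0 \<Rightarrow> t | Suc s \<Rightarrow> w s)" if "p \<in> flat t b w" "i \<notin> Suc ` {..<b}" for p i
    using that by (cases i) (auto simp: flat_def image_iff)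
qed

text \<open>
  The flat contains a translate of the unit cube of dimension \<open>b\<close>, with corner \<open>w\<close>; adding to it a set
  that is thin of the same order does not change the upper bound.
\<close>

lemma dim_top_of_flat_union:
  assumes "flat t b w \<union> C \<subseteq> jet_space k" and C: "thin jet_coord (Suc b) C"
  shows "dim_top (subtopology (jet_topology k) (flat t b w \<union> C)) = ereal (real b)"
proof (rule dim_top_jet_eqI [where \<phi> = "\<lambda>x. (t, \<lambda>s. w s + x s)" and \<pi> = "\<lambda>s p. snd p s - w s"])
  show "thin jet_coord (Suc b) (flat t b w \<union> C)"
    using thin_jet_flat C by (rule thin_Un)
  show "continuous_on (unit_cube b) (\<lambda>x. (t, \<lambda>s. w s + x s))"
    by (intro continuous_intros continuous_on_coordinatewise_then_product
          continuous_on_subset [OF continuous_on_product_coordinates]) auto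
  show "continuous_on UNIV (\<lambda>p :: jet_point. snd p s - w s)" for s
    by (intro continuous_intros continuous_on_product_then_coordinatewise)
qed (use assms in \<open>auto simp: unit_cube_def flat_def\<close>)

section \<open>The vertical map\<close>

lemma inv_jet:
  assumes "(y, v) \<in> jet_space k"
  shows "inv\<^bsub>jet_group k\<^esub> (y, v) = (- y, \<lambda>s. - jet_shift k (- y) v s)"
proof -
  interpret group "jet_group k" by (rule group_jet_group)
  have in_sp: "(- y, \<lambda>s. - jet_shift k (- y) v s) \<in> jet_space k"
    using jet_shift_in [of "- y" k "- y" v] by (simp add: jet_space_def)
  have "jet_mult k (- y, \<lambda>s. - jet_shift k (- y) v s) (y, v) = (0, \<lambda>s. 0)"
    using assms by (simp add: jet_mult_shift [OF in_sp] jet_shift_minus jet_shift_shift jet_shift_0)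
  with assms in_sp show ?thesis
    by (intro inv_equality) (simp_all add: jet_group_def)
qed

lemma vert_map_eq:
  assumes "(x, u) \<in> jet_space k"
  shows "vert_map k f t (x, u) =
    (t, \<lambda>s. jet_shift k (t - x) u s - jet_shift k (t - x) (snd (jet k f (x - t))) s)"
proof -
  have "jet k f (x - t) = (x - t, snd (jet k f (x - t)))" by (simp add: jet_def)
  moreover from this have "inv\<^bsub>jet_group k\<^esub> (x - t, snd (jet k f (x - t))) =
      (t - x, \<lambda>s. - jet_shift k (t - x) (snd (jet k f (x - t))) s)"
    using inv_jet [of "x - t" "snd (jet k f (x - t))" k] jet_in [of k f "x - t"] by simp
  ultimately show ?thesis
    using jet_mult_shift [OF assms] by (simp add: vert_map_def jet_group_def)
qed

lemma flat_subset_jet_space: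
  assumes "b \<le> k + 1" "\<And>s. s > k \<Longrightarrow> w s = 0"
  shows "flat t b w \<subseteq> jet_space k"
  using assms by (auto simp: flat_def jet_space_def)

text \<open>
  On the fibre \<open>{x = t}\<close> the vertical map is the translation by \<open>- j\<^sup>k\<^sub>0(f)\<close>, since the mixed terms of the
  group operation carry powers of \<open>t - x = 0\<close>.
\<close>

lemma vert_map_image_flat:
  assumes b: "b \<le> k + 1"
  shows "vert_map k f t ` flat t b (\<lambda>s. 0) = flat t b (\<lambda>s. - snd (jet k f 0) s)"
proof -
  have vert: "vert_map k f t (t, u) = (t, \<lambda>s. u s - snd (jet k f 0) s)" if "(t, u) \<in> jet_space k" for u
  proof -
    have "(t, snd (jet k f 0)) \<in> jet_space k" by (simp add: jet_def jet_space_def)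
    with that show ?thesis by (simp add: vert_map_eq jet_shift_0)
  qed
  have sub: "flat t b (\<lambda>s. 0) \<subseteq> jet_space k" using b by (rule flat_subset_jet_space) simp
  show ?thesis
  proof (intro equalityI subsetI)
    fix p assume "p \<in> vert_map k f t ` flat t b (\<lambda>s. 0)"
    then obtain u where "(t, u) \<in> flat t b (\<lambda>s. 0)" "p = vert_map k f t (t, u)"
      by (auto simp: flat_def)
    with sub show "p \<in> flat t b (\<lambda>s. - snd (jet k f 0) s)"
      by (auto simp: vert flat_def subset_iff)
  next
    fix p assume "p \<in> flat t b (\<lambda>s. - snd (jet k f 0) s)"
    then obtain u where u: "p = (t, u)" "\<And>s. s \<ge> b \<Longrightarrow> u s = - snd (jet k f 0) s"
      by (auto simp: flat_def)
    then have q: "(t, \<lambda>s. u s + snd (jet k f 0) s) \<in> flat t b (\<lambda>s. 0)"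
      by (simp add: flat_def)
    with sub have "p = vert_map k f t (t, \<lambda>s. u s + snd (jet k f 0) s)"
      by (subst vert) (auto simp: u(1))
    then show "p \<in> vert_map k f t ` flat t b (\<lambda>s. 0)" using q by (rule image_eqI)
  qed
qed

lemma smooth_real_derivs_differentiable:
  assumes "smooth_real f"
  shows "(deriv ^^ n) f differentiable (at x)"
  using assms by (simp add: smooth_real_def differentiable_on_eq_differentiable_at)

lemma thin_axis: "thin jet_coord 2 ((\<lambda>x. (x, \<lambda>s. 0)) ` {a..b})"
proof (rule thin_curve)
  show "(\<lambda>x. jet_coord i (x, \<lambda>s. 0)) differentiable_on {a..b}" for i
    by (cases i) auto
qed

text \<open>
  By the formula for the vertical map, the coordinates along the image are sums of products of
  derivatives of \<open>f\<close> with powers of \<open>t - x\<close>.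
\<close>

lemma thin_vert_map_axis:
  assumes f: "smooth_real f"
  shows "thin jet_coord 2 (vert_map k f t ` (\<lambda>x. (x, \<lambda>s. 0)) ` {a..b})"
  unfolding image_image
proof (rule thin_curve)
  fix i
  have shift: "jet_shift k y (snd (jet k f z)) s
      = (\<Sum>j = s..k. (deriv ^^ j) f z * (y ^ (j - s) / fact (j - s)))" for y z s
    unfolding jet_shift_def jet_def by (intro sum.cong) auto
  have deriv: "(\<lambda>x. (deriv ^^ j) f (x - t)) differentiable (at x within {a..b})" for j x
    by (rule differentiable_compose [OF smooth_real_derivs_differentiable [OF f]]) simp
  have "(\<lambda>x. (deriv ^^ j) f (x - t) * ((t - x) ^ (j - s) / fact (j - s))) differentiable (at x within {a..b})" for j s x
    by (intro differentiable_mult deriv differentiable_divide differentiable_power differentiable_diff) auto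
  then have "(\<lambda>x. - jet_shift k (t - x) (snd (jet k f (x - t))) s) differentiable (at x within {a..b})" for s x
    unfolding shift by (intro differentiable_minus differentiable_sum ballI) auto
  moreover have "vert_map k f t (x, \<lambda>s. 0) = (t, \<lambda>s. - jet_shift k (t - x) (snd (jet k f (x - t))) s)" for x
    by (subst vert_map_eq) (simp_all add: jet_space_def jet_shift_def)
  ultimately show "(\<lambda>x. jet_coord i (vert_map k f t (x, \<lambda>s. 0))) differentiable_on {a..b}"
    by (cases i) (auto simp: differentiable_on_def)
qed

section \<open>Jets and the final construction\<close>

text \<open>
  The jet of \<open>f\<close> is a graph over the variable \<open>x\<close>, which recovers the parameter and gives the lower
  bound; differentiability gives the upper one.
\<close>

lemma dim_top_jet_arc:
  assumes f: "smooth_real f"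
  shows "dim_top (subtopology (jet_topology k) (jet k f ` {0..1})) = ereal 1"
proof -
  have diff: "(\<lambda>x. if s \<le> k then (deriv ^^ s) f x else 0) differentiable_on S" for s S
    using smooth_real_derivs_differentiable [OF f]
    by (cases "s \<le> k") (auto intro: differentiable_at_imp_differentiable_on)
  have "dim_top (subtopology (jet_topology k) (jet k f ` {0..1})) = ereal (real 1)"
  proof (rule dim_top_jet_eqI [where \<phi> = "\<lambda>x. jet k f (x 0)" and \<pi> = "\<lambda>i. fst"])
    show "thin jet_coord (Suc 1) (jet k f ` {0..1})"
      unfolding Suc_1
    proof (rule thin_curve)
      show "(\<lambda>x. jet_coord i (jet k f x)) differentiable_on {0..1}" for i
        using diff by (cases i) (auto simp: jet_def)
    qed
    have "continuous_on UNIV (\<lambda>x. if s \<le> k then (deriv ^^ s) f x else 0)" for s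
      using diff by (rule differentiable_imp_continuous_on)
    then have "continuous_on UNIV (jet k f)"
      unfolding jet_def by (intro continuous_on_Pair continuous_on_id continuous_on_coordinatewise_then_product)
    then show "continuous_on (unit_cube 1) (\<lambda>x. jet k f (x 0))"
      by (rule continuous_on_compose2) (auto intro: continuous_on_subset [OF continuous_on_product_coordinates])
    show "jet k f ` {0..1} \<subseteq> jet_space k" using jet_in by blast
    show "(\<lambda>x. jet k f (x 0)) ` unit_cube 1 \<subseteq> jet k f ` {0..1}"
      unfolding unit_cube_def by fastforce
    show "continuous_on UNIV (fst :: jet_point \<Rightarrow> real)"
      by (intro continuous_intros)
  qed (simp add: jet_def)
  then show ?thesis by simp
qed

lemma dim_top_jet_point:
  assumes "p \<in> jet_space k"
  shows "dim_top (subtopology (jet_topology k) {p}) = ereal 0"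
proof -
  have "dim_top (subtopology (jet_topology k) {p}) = ereal (real 0)"
  proof (rule dim_top_jet_eqI [where \<phi> = "\<lambda>x. p" and \<pi> = "\<lambda>i p. 0"])
    show "thin jet_coord (Suc 0) {p}"
      by (rule thin_flat [of "{}" _ _ _ "\<lambda>i. jet_coord i p"]) auto
  qed (use assms in auto)
  then show ?thesis by simp
qed

theorem proposition6p2:
  fixes k a b :: nat and t :: real
  assumes "1 \<le> k" and "a \<in> {0, 1}" and "b \<in> {1..k + 1}"
  shows "\<exists>F. F \<subseteq> jet_space k \<and>
    (\<forall>f. smooth_real f \<longrightarrow>
      dim_top (subtopology (jet_topology k) (horiz_map k f t ` F)) = ereal (real a) \<and>
      dim_top (subtopology (jet_topology k) (vert_map k f t ` F)) = ereal (real b)) \<and>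
    dim_top (subtopology (jet_topology k) F) = ereal (real b)"
proof -
  have b: "b \<le> k + 1" "2 \<le> Suc b" using assms(3) by auto
  define E where "E = flat t b (\<lambda>s. 0)"
  define C where "C = (if a = 0 then {} else (\<lambda>x. (x, \<lambda>s::nat. 0 :: real)) ` {t..t + 1})"
  have E: "E \<subseteq> jet_space k"
    unfolding E_def using b(1) by (rule flat_subset_jet_space) simp
  have C: "C \<subseteq> jet_space k"
    by (auto simp: C_def jet_space_def)
  have tE: "(t, \<lambda>s. 0) \<in> E" and fstE: "\<And>p. p \<in> E \<Longrightarrow> fst p = t"
    by (auto simp: E_def flat_def)
  have "thin jet_coord (Suc b) C"
  proof (cases "a = 0")
    case True
    then show ?thesis by (simp add: C_def thin_empty del: thin.simps)
  next
    case False
    then show ?thesis using thin_mono [OF thin_axis b(2)] by (simp only: C_def if_False)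
  qed
  with E C have dimF: "dim_top (subtopology (jet_topology k) (E \<union> C)) = ereal (real b)"
    unfolding E_def by (simp only: dim_top_of_flat_union Un_least)
  have "dim_top (subtopology (jet_topology k) (horiz_map k f t ` (E \<union> C))) = ereal (real a) \<and>
      dim_top (subtopology (jet_topology k) (vert_map k f t ` (E \<union> C))) = ereal (real b)"
    if f: "smooth_real f" for f
  proof
    have "horiz_map k f t ` E = {jet k f 0}"
    proof -
      have "horiz_map k f t ` E = (\<lambda>p. jet k f 0) ` E"
        using fstE by (intro image_cong) (simp_all add: horiz_map_def)
      with tE show ?thesis by (simp only: image_constant)
    qed
    moreover have "horiz_map k f t ` (\<lambda>x. (x, \<lambda>s::nat. 0 :: real)) ` {t..t + 1} = jet k f ` {0..1}"
    proof -
      have "horiz_map k f t ` (\<lambda>x. (x, \<lambda>s::nat. 0 :: real)) ` {t..t + 1} = jet k f ` (\<lambda>x. x - t) ` {t..t + 1}"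
        unfolding image_image horiz_map_def by (simp only: fst_conv)
      also have "(\<lambda>x. x - t) ` {t..t + 1} = {0..1}" by simp
      finally show ?thesis .
    qed
    ultimately have "horiz_map k f t ` (E \<union> C) = (if a = 0 then {jet k f 0} else jet k f ` {0..1})"
      unfolding C_def image_Un by (cases "a = 0") auto
    then show "dim_top (subtopology (jet_topology k) (horiz_map k f t ` (E \<union> C))) = ereal (real a)"
      using assms(2) dim_top_jet_point [OF jet_in] dim_top_jet_arc [OF f] by (cases "a = 0") simp_all
    have "thin jet_coord (Suc b) (vert_map k f t ` C)"
    proof (cases "a = 0")
      case True
      then show ?thesis by (simp add: C_def thin_empty del: thin.simps)
    next
      case False
      then show ?thesis using thin_mono [OF thin_vert_map_axis [OF f] b(2)] by (simp only: C_def if_False)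
    qed
    moreover have "vert_map k f t ` (E \<union> C) \<subseteq> jet_space k"
      using E C vert_map_in by blast
    ultimately show "dim_top (subtopology (jet_topology k) (vert_map k f t ` (E \<union> C))) = ereal (real b)"
      unfolding image_Un E_def vert_map_image_flat [OF b(1)] by (rule dim_top_of_flat_union [rotated])
  qed
  with E C dimF show ?thesis
    by (intro exI [of _ "E \<union> C"] conjI allI impI Un_least) blast+
qed

end
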